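(* Let $D$ be a non-empty set, let $X$ be a Banach space, let $V$ and $W$ be Banach spaces with $W\subseteq F(D,X)$, let $M$ be a vector space, and let $B:M\times V\to W$ be a bilinear operator. If $W$ is a BK-space, then $M$ is $B$-normed if and only if both of the following properties hold: (I) for each $f\in M$ such that $B(f,v)=0$ for all $v\in V$, one has $f=0$; (II) for each sequence $\{v_k\}_k\subseteq V$ and each $v\in V$ such that $v_k\to v$ in $V$, one has $B(f,v_k)(a)\to B(f,v)(a)$ in $X$ for every $a\in D$ and every $f\in M$.
   Context: All vector spaces are over $\mathbb K=\mathbb R$ or $\mathbb K=\mathbb C$. $F(D,X)$ is the vector space of all functions $f:D\to X$. A normed space $U$ that is a vector subspace of $F(D,X)$ (with its own norm) has continuous evaluations if for each $a\in D$ the map $U\to X$, $u\mapsto u(a)$, is continuous; a BK-space is a complete such space. For a bilinear operator $B:M\times V\to W$ with $V,W$ normed and $M$ a vector space (no norm given), put $\|f\|_M:=\sup\{\|B(f,v)\|_W:\|v\|_V\le 1\}\in[0,\infty]$ for $f\in M$. $M$ is called $B$-normed if $\|\cdot\|_M$ is a norm on $M$ (in particular finite-valued). *)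

theory Defs
  imports "HOL-Analysis.Analysis" "HOL-Library.Function_Algebras"
begin

text \<open>
  The scalar field is an arbitrary \<open>'k::real_normed_field\<close>. Both \<open>real\<close> and \<open>complex\<close> are instances,
  and by the Gelfand-Mazur theorem every instance is isometrically isomorphic to one of them.
\<close>

text \<open>
  The class \<open>banach\<close> supplies addition, norm and completeness; the locale adds the scalar
  multiplication by \<open>'k\<close>. Compatibility with the real scaling of the class,
  \<open>scl (of_real r) x = r *\<^sub>R x\<close>, follows: both sides are additive and continuous in \<open>r\<close> and they
  agree for \<open>r = 1\<close>.
\<close>

locale banach_space_over = vector_space scl
  for scl :: "'k::real_normed_field \<Rightarrow> 'a::banach \<Rightarrow> 'a" +
  assumes norm_scale: "norm (scl c x) = norm c * norm x"

definition is_norm_on ::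
    "('k::real_normed_field \<Rightarrow> 'a::ab_group_add \<Rightarrow> 'a) \<Rightarrow> 'a set \<Rightarrow> ('a \<Rightarrow> real) \<Rightarrow> bool" where
  "is_norm_on scl U N \<longleftrightarrow>
     (\<forall>x\<in>U. 0 \<le> N x) \<and>
     (\<forall>x\<in>U. N x = 0 \<longleftrightarrow> x = 0) \<and>
     (\<forall>c. \<forall>x\<in>U. N (scl c x) = norm c * N x) \<and>
     (\<forall>x\<in>U. \<forall>y\<in>U. N (x + y) \<le> N x + N y)"

definition pointwise_scale :: "('k \<Rightarrow> 'x \<Rightarrow> 'x) \<Rightarrow> 'k \<Rightarrow> ('d \<Rightarrow> 'x) \<Rightarrow> 'd \<Rightarrow> 'x" where
  "pointwise_scale scl c f = (\<lambda>a. scl c (f a))"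

lemma vector_space_pointwise_scale:
  assumes "vector_space scl"
  shows "vector_space (pointwise_scale scl)"
proof -
  interpret vector_space scl by fact
  show ?thesis
    by unfold_locales
      (auto simp: pointwise_scale_def fun_eq_iff scale_right_distrib scale_left_distrib)
qed

text \<open>
  \<open>F(D, X)\<close>: a function on the set \<open>D\<close> is represented by its extension by zero to the whole type,
  so that the pointwise operations of the function type are those of \<open>F(D, X)\<close>.
\<close>

definition functions_on :: "'d set \<Rightarrow> ('d \<Rightarrow> 'x::zero) set" where
  "functions_on D = {f. \<forall>a. a \<notin> D \<longrightarrow> f a = 0}"

text \<open>
  A normed space of functions is a carrier \<open>U\<close> with a norm \<open>N\<close> of its own; the values of \<open>N\<close> outside
  \<open>U\<close> are irrelevant.
\<close>

definition normed_function_space ::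
    "('k::real_normed_field \<Rightarrow> 'x::ab_group_add \<Rightarrow> 'x) \<Rightarrow> 'd set \<Rightarrow> ('d \<Rightarrow> 'x) set
      \<Rightarrow> (('d \<Rightarrow> 'x) \<Rightarrow> real) \<Rightarrow> bool" where
  "normed_function_space scl D U N \<longleftrightarrow>
     U \<subseteq> functions_on D \<and>
     module.subspace (pointwise_scale scl) U \<and>
     is_norm_on (pointwise_scale scl) U N"

text \<open>
  \<open>Metric_space\<close> demands a nonnegative symmetric distance on the whole type, hence the value 0 off \<open>U\<close>.
\<close>

definition norm_dist :: "'a set \<Rightarrow> ('a::minus \<Rightarrow> real) \<Rightarrow> 'a \<Rightarrow> 'a \<Rightarrow> real" where
  "norm_dist U N u v = (if u \<in> U \<and> v \<in> U then N (u - v) else 0)"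

lemma Metric_space_norm_dist:
  assumes X: "vector_space scl" and U: "normed_function_space scl D U N"
  shows "Metric_space U (norm_dist U N)"
proof -
  interpret P: vector_space "pointwise_scale scl"
    by (rule vector_space_pointwise_scale [OF X])
  have sub: "P.subspace U" and nm: "is_norm_on (pointwise_scale scl) U N"
    using U by (auto simp: normed_function_space_def)
  have mem: "u - v \<in> U" if "u \<in> U" "v \<in> U" for u v
    using P.subspace_diff [OF sub] that by blast
  have nonneg: "0 \<le> N u" and zero: "N u = 0 \<longleftrightarrow> u = 0"
    and scl: "N (pointwise_scale scl c u) = norm c * N u" if "u \<in> U" for u c
    using nm that by (auto simp: is_norm_on_def)
  have triangle: "N (u + v) \<le> N u + N v" if "u \<in> U" "v \<in> U" for u v
    using nm that by (auto simp: is_norm_on_def)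
  have commute: "N (u - v) = N (v - u)" if "u \<in> U" "v \<in> U" for u v
    using scl [OF mem [OF that], of "- 1"] by simp
  show ?thesis
  proof
    show "norm_dist U N u w \<le> norm_dist U N u v + norm_dist U N v w"
      if "u \<in> U" "v \<in> U" "w \<in> U" for u v w
      using triangle [OF mem [OF that(1,2)] mem [OF that(2,3)]] that
      by (simp add: norm_dist_def)
  qed (auto simp: norm_dist_def nonneg zero mem commute)
qed

definition banach_function_space ::
    "('k::real_normed_field \<Rightarrow> 'x::ab_group_add \<Rightarrow> 'x) \<Rightarrow> 'd set \<Rightarrow> ('d \<Rightarrow> 'x) set
      \<Rightarrow> (('d \<Rightarrow> 'x) \<Rightarrow> real) \<Rightarrow> bool" where
  "banach_function_space scl D U N \<longleftrightarrow>
     normed_function_space scl D U N \<and> Metric_space.mcomplete U (norm_dist U N)"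

definition continuous_evaluations ::
    "'d set \<Rightarrow> ('d \<Rightarrow> 'x::real_normed_vector) set \<Rightarrow> (('d \<Rightarrow> 'x) \<Rightarrow> real) \<Rightarrow> bool" where
  "continuous_evaluations D U N \<longleftrightarrow>
     (\<forall>a\<in>D. continuous_map (Metric_space.mtopology U (norm_dist U N)) euclidean (\<lambda>u. u a))"

definition BK_space ::
    "('k::real_normed_field \<Rightarrow> 'x::real_normed_vector \<Rightarrow> 'x) \<Rightarrow> 'd set \<Rightarrow> ('d \<Rightarrow> 'x) set
      \<Rightarrow> (('d \<Rightarrow> 'x) \<Rightarrow> real) \<Rightarrow> bool" where
  "BK_space scl D U N \<longleftrightarrow>
     banach_function_space scl D U N \<and> continuous_evaluations D U N"

definition bilinear_over ::
    "('k::field \<Rightarrow> 'm::ab_group_add \<Rightarrow> 'm) \<Rightarrow> ('k \<Rightarrow> 'v::ab_group_add \<Rightarrow> 'v)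
      \<Rightarrow> ('k \<Rightarrow> 'w::ab_group_add \<Rightarrow> 'w) \<Rightarrow> ('m \<Rightarrow> 'v \<Rightarrow> 'w) \<Rightarrow> bool" where
  "bilinear_over scaleM scaleV scaleW B \<longleftrightarrow>
     (\<forall>f. Vector_Spaces.linear scaleV scaleW (B f)) \<and>
     (\<forall>v. Vector_Spaces.linear scaleM scaleW (\<lambda>f. B f v))"

definition B_norm ::
    "('w \<Rightarrow> real) \<Rightarrow> ('m \<Rightarrow> 'v::real_normed_vector \<Rightarrow> 'w) \<Rightarrow> 'm \<Rightarrow> ennreal" where
  "B_norm N B f = (SUP v\<in>{v. norm v \<le> 1}. ennreal (N (B f v)))"

definition B_normed ::
    "('k::real_normed_field \<Rightarrow> 'm::ab_group_add \<Rightarrow> 'm) \<Rightarrow> ('w \<Rightarrow> real)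
      \<Rightarrow> ('m \<Rightarrow> 'v::real_normed_vector \<Rightarrow> 'w) \<Rightarrow> bool" where
  "B_normed scaleM N B \<longleftrightarrow>
     (\<forall>f. B_norm N B f < \<infinity>) \<and> is_norm_on scaleM UNIV (\<lambda>f. enn2real (B_norm N B f))"

end

theory Submission
  imports Defs
begin

text \<open>
  A \<open>B\<close>-norm makes every \<open>B f\<close> bounded, and evaluations are continuous, which gives (II). Conversely
  (II) and continuous evaluations identify any limit of \<open>B f v\<^sub>k\<close> in \<open>W\<close> pointwise as \<open>B f v\<close>, so
  \<open>B f\<close> has closed graph. The closed graph theorem gives its boundedness, and (I) makes the operator
  seminorm definite.
\<close>

section \<open>Normed spaces of functions on a carrier set\<close>

locale normed_functions = vector_space scl
  for scl :: "'k::real_normed_field \<Rightarrow> 'x::ab_group_add \<Rightarrow> 'x" +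
  fixes D :: "'d set" and W :: "('d \<Rightarrow> 'x) set" and N :: "('d \<Rightarrow> 'x) \<Rightarrow> real"
  assumes normed: "normed_function_space scl D W N"
begin

sublocale P: vector_space "pointwise_scale scl"
  by (rule vector_space_pointwise_scale) (rule vector_space_axioms)

sublocale M: Metric_space W "norm_dist W N"
  by (rule Metric_space_norm_dist [OF vector_space_axioms normed])

lemma subspace_W: "P.subspace W" and norm_W: "is_norm_on (pointwise_scale scl) W N"
  using normed by (auto simp: normed_function_space_def)

text \<open>Neither evaluations nor (II) reach points off \<open>D\<close>; there this vanishing
  makes a limit in \<open>W\<close> agree with its candidate.\<close>

lemma eq_0_outside: "u \<in> W \<Longrightarrow> a \<notin> D \<Longrightarrow> u a = 0"
  using normed by (auto simp: normed_function_space_def functions_on_def)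

lemma diff_mem: "u \<in> W \<Longrightarrow> v \<in> W \<Longrightarrow> u - v \<in> W"
  using P.subspace_diff [OF subspace_W] .

lemma N_nonneg: "u \<in> W \<Longrightarrow> 0 \<le> N u"
  and N_eq_0_iff: "u \<in> W \<Longrightarrow> N u = 0 \<longleftrightarrow> u = 0"
  and N_scale: "u \<in> W \<Longrightarrow> N (pointwise_scale scl c u) = norm c * N u"
  and N_triangle: "u \<in> W \<Longrightarrow> v \<in> W \<Longrightarrow> N (u + v) \<le> N u + N v"
  using norm_W by (auto simp: is_norm_on_def)

lemma N_0: "N 0 = 0"
  using N_eq_0_iff P.subspace_0 [OF subspace_W] by blast

lemma N_minus_commute: "u \<in> W \<Longrightarrow> v \<in> W \<Longrightarrow> N (u - v) = N (v - u)"
  using M.commute [of u v] by (simp add: norm_dist_def)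

text \<open>The triangle inequality of the metric, taken through the point 0.\<close>

lemma N_triangle_diff: "u \<in> W \<Longrightarrow> v \<in> W \<Longrightarrow> N (u - v) \<le> N u + N v"
  using M.triangle [of u 0 v] N_minus_commute [of 0 v] P.subspace_0 [OF subspace_W]
  by (simp add: norm_dist_def)

end

section \<open>Closed graph theorem for operators from a Banach space into \<open>W\<close>\<close>

locale operator_into_functions =
  normed_functions scl D W N + V: banach_space_over scaleV +
  T: Vector_Spaces.linear scaleV "pointwise_scale scl" T
  for scl :: "'k::real_normed_field \<Rightarrow> 'x::ab_group_add \<Rightarrow> 'x" and D :: "'d set" and W N
    and scaleV :: "'k \<Rightarrow> 'v::banach \<Rightarrow> 'v" and T +
  assumes range_T: "T v \<in> W"
begin

text \<open>Homogeneity: a nonzero \<open>v\<close> is rescaled to norm 1, and the factor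
  \<open>norm v\<close> is restored afterwards.\<close>

lemma bound_of_unit_ball_bound:
  assumes "\<And>u. norm u \<le> 1 \<Longrightarrow> N (T u) \<le> C"
  shows "N (T v) \<le> C * norm v"
proof (cases "v = 0")
  case True
  then show ?thesis by (simp add: T.zero N_0)
next
  case False
  define u where "u = scaleV (of_real (inverse (norm v))) v"
  have "norm u = 1"
    using False by (simp add: u_def V.norm_scale norm_inverse)
  then have "N (T u) \<le> C"
    using assms by simp
  moreover have "N (T u) = N (T v) / norm v"
    by (simp add: u_def T.scale N_scale range_T norm_inverse divide_inverse mult.commute)
  ultimately show ?thesis
    using False by (simp add: divide_le_eq)
qed

text \<open>
  Baire category makes \<open>{u. N (T u) \<le> n}\<close> dense in some ball around \<open>x\<close>; differences of
  approximants of \<open>x + v\<close> and \<open>x\<close> then approximate \<open>v\<close>.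
\<close>
lemma approx_near_0:
  obtains r C where "0 < r" "0 \<le> C"
    "\<And>v e. norm v < r \<Longrightarrow> 0 < e \<Longrightarrow> \<exists>u. N (T u) \<le> C \<and> norm (v - u) < e"
proof -
  define E where "E n = {u. N (T u) \<le> real n}" for n
  have "(\<Union>n. closure (E n)) = UNIV"
  proof -
    have "\<exists>n. v \<in> E n" for v
      using real_arch_simple by (auto simp: E_def)
    then show ?thesis
      by (auto intro: subsetD [OF closure_subset])
  qed
  \<comment> \<open>Baire category in the domain: if all these closed sets had empty interior, so
    would their union, which is the whole space.\<close>
  moreover have "interior (\<Union>n. closure (E n)) = {}" if "\<And>n. interior (closure (E n)) = {}"
  proof -
    have "Met_TC.mtopology interior_of \<Union> (range (\<lambda>n. closure (E n))) = {}"
      by (rule Met_TC.metric_Baire_category_alt) (auto simp: that complete_UNIV)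
    then show ?thesis by simp
  qed
  ultimately obtain n where "interior (closure (E n)) \<noteq> {}"
    by (metis UNIV_not_empty interior_UNIV)
  then obtain x r where r: "0 < r" and ball: "ball x r \<subseteq> closure (E n)"
    by (metis all_not_in_conv mem_interior)
  show thesis
  \<comment> \<open>A difference of two elements of \<open>E n\<close> costs \<open>real n\<close>
    twice.\<close>
  proof (rule that [of r "2 * real n"])
    fix v :: 'v and e :: real
    assume v: "norm v < r" and e: "0 < e"
    have "x + v \<in> closure (E n)" "x \<in> closure (E n)"
      using ball v r by (auto simp: dist_norm)
    then obtain y z where y: "y \<in> E n" "dist y (x + v) < e / 2" and z: "z \<in> E n" "dist z x < e / 2"
      by (meson closure_approachable e half_gt_zero)
    have "N (T (y - z)) \<le> 2 * real n"
      using y z N_triangle_diff [OF range_T range_T, of y z] by (simp add: E_def T.diff)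
    moreover have "norm (v - (y - z)) < e"
    proof -
      have "v - (y - z) = (z - x) - (y - (x + v))" by simp
      then have "norm (v - (y - z)) \<le> norm (z - x) + norm (y - (x + v))"
        by (metis norm_triangle_ineq4)
      then show ?thesis using y z by (simp add: dist_norm)
    qed
    ultimately show "\<exists>u. N (T u) \<le> 2 * real n \<and> norm (v - u) < e" by blast
  qed (use r in auto)
qed

text \<open>Successive approximation writes \<open>v\<close> as a series whose terms have images
  bounded by \<open>C / 2 ^ k\<close>. Completeness of \<open>W\<close> makes the image series
  converge, and closedness identifies its sum as \<open>T v\<close>, so \<open>T\<close> is bounded
  on a ball.\<close>

theorem closed_graph:
  assumes complete: "M.mcomplete"
    and closed: "\<And>vs v w. vs \<longlonglongrightarrow> v \<Longrightarrow>
      limitin M.mtopology (\<lambda>k. T (vs k)) w sequentially \<Longrightarrow> w = T v"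
  obtains K where "\<And>v. N (T v) \<le> K * norm v"
proof -
  obtain r C where r: "0 < r" and C: "0 \<le> C"
    and approx: "\<And>v e. norm v < r \<Longrightarrow> 0 < e \<Longrightarrow> \<exists>u. N (T u) \<le> C \<and> norm (v - u) < e"
    by (rule approx_near_0) blast
  \<comment> \<open>Scaling by \<open>2 ^ k\<close> and back transports the approximation to radius
    \<open>r / 2 ^ k\<close>. The error \<open>r / 2\<close> is chosen so that the remainder
    \<open>v - u\<close> meets the premise for \<open>Suc k\<close>.\<close>
  have approx_k: "\<exists>u. N (T u) \<le> C / 2 ^ k \<and> norm (v - u) < r / 2 ^ Suc k"
    if "norm v < r / 2 ^ k" for v k
  proof -
    have "norm (scaleV (2 ^ k) v) < r"
      using that by (simp add: V.norm_scale norm_power field_simps)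
    then obtain u where u: "N (T u) \<le> C" "norm (scaleV (2 ^ k) v - u) < r / 2"
      using approx [of _ "r / 2"] r by (metis half_gt_zero)
    let ?u = "scaleV (inverse (2 ^ k)) u"
    have "N (T ?u) \<le> C / 2 ^ k"
      using u by (simp add: T.scale N_scale range_T norm_inverse norm_divide norm_power field_simps)
    moreover have "v - ?u = scaleV (inverse (2 ^ k)) (scaleV (2 ^ k) v - u)"
      by (simp add: V.scale_right_diff_distrib)
    then have "norm (v - ?u) = norm (scaleV (2 ^ k) v - u) / 2 ^ k"
      by (simp add: V.norm_scale norm_inverse norm_power divide_inverse mult.commute)
    then have "norm (v - ?u) < r / 2 ^ Suc k"
      using u by (simp add: field_simps)
    ultimately show ?thesis by blast
  qed
  have small: "N (T v) \<le> 2 * C + 1" if v: "norm v < r" for v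
  proof -
    \<comment> \<open>\<open>x k\<close> is the remainder after \<open>k\<close> approximations, and
      \<open>x k - x (Suc k)\<close> is the next approximant. The clause for \<open>k = 0\<close>
      pins the start at \<open>v\<close>.\<close>
    have "\<exists>x. \<forall>k. (norm (x k) < r / 2 ^ k \<and> (k = 0 \<longrightarrow> x k = v)) \<and>
        N (T (x k - x (Suc k))) \<le> C / 2 ^ k"
    proof (rule dependent_nat_choice)
      show "\<exists>x. norm x < r / 2 ^ 0 \<and> (0 = 0 \<longrightarrow> x = v)"
        using v by auto
      fix x k
      assume "norm x < r / 2 ^ k \<and> (k = 0 \<longrightarrow> x = v)"
      then obtain u where "N (T u) \<le> C / 2 ^ k" "norm (x - u) < r / 2 ^ Suc k"
        using approx_k by blast
      then show "\<exists>y. (norm y < r / 2 ^ Suc k \<and> (Suc k = 0 \<longrightarrow> y = v)) \<and> N (T (x - y)) \<le> C / 2 ^ k"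
        by (intro exI [of _ "x - u"]) auto
    qed
    then obtain x where x: "\<And>k. norm (x k) < r / 2 ^ k" "x 0 = v"
        "\<And>k. N (T (x k - x (Suc k))) \<le> C / 2 ^ k"
      by blast
    \<comment> \<open>These are the partial sums of the approximants, starting at
      \<open>vs 0 = 0\<close>.\<close>
    define vs where "vs k = v - x k" for k
    have "(\<lambda>k. r * (1 / 2) ^ k) \<longlonglongrightarrow> r * 0"
      by (intro tendsto_intros) simp
    then have "(\<lambda>k. r / 2 ^ k) \<longlonglongrightarrow> 0"
      by (simp add: power_one_over)
    then have "x \<longlonglongrightarrow> 0"
      by (rule Lim_null_comparison [rotated]) (simp add: x(1) less_imp_le)
    then have vs: "vs \<longlonglongrightarrow> v"
      unfolding vs_def using tendsto_diff [of "\<lambda>_. v" v] by fastforce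
    \<comment> \<open>The right-hand side is the geometric sum in closed form; keeping the
      subtracted term lets the induction close.\<close>
    have tail: "N (T (vs (m + j)) - T (vs m)) \<le> 2 * C / 2 ^ m - 2 * C / 2 ^ (m + j)" for m j
    proof (induction j)
      case 0
      show ?case by (simp only: add_0_right diff_self N_0 order_refl)
    next
      case (Suc j)
      have "T (vs (m + Suc j)) - T (vs m) =
          T (x (m + j) - x (Suc (m + j))) + (T (vs (m + j)) - T (vs m))"
        by (simp add: vs_def T.diff)
      then have "N (T (vs (m + Suc j)) - T (vs m)) \<le>
          N (T (x (m + j) - x (Suc (m + j)))) + N (T (vs (m + j)) - T (vs m))"
        by (simp only: N_triangle range_T diff_mem)
      also have "\<dots> \<le> C / 2 ^ (m + j) + (2 * C / 2 ^ m - 2 * C / 2 ^ (m + j))"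
        using x(3) Suc by (rule add_mono)
      also have "\<dots> = 2 * C / 2 ^ m - 2 * C / 2 ^ (m + Suc j)"
        by simp
      finally show ?case .
    qed
    have dist: "norm_dist W N (T (vs n)) (T (vs m)) \<le> 2 * C / 2 ^ m" if "m \<le> n" for m n
    proof -
      have "0 \<le> 2 * C / 2 ^ n"
        using C by simp
      then show ?thesis
        using tail [of m "n - m"] that by (simp add: norm_dist_def range_T)
    qed
    have "M.MCauchy (\<lambda>k. T (vs k))"
      unfolding M.MCauchy_def
    proof (intro conjI allI impI)
      fix e :: real
      assume "0 < e"
      \<comment> \<open>Going through \<open>T (vs m)\<close> costs two tails of size
        \<open>2 * C / 2 ^ m\<close>, hence the 4.\<close>
      have "(\<lambda>k. 4 * C * (1 / 2) ^ k) \<longlonglongrightarrow> 4 * C * 0"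
        by (intro tendsto_intros) simp
      then have "\<forall>\<^sub>F k in sequentially. 4 * C * (1 / 2) ^ k < e"
        using \<open>0 < e\<close> by (auto intro: order_tendstoD)
      then obtain m where m: "4 * C / 2 ^ m < e"
        by (auto simp: eventually_sequentially power_one_over)
      have "norm_dist W N (T (vs n)) (T (vs n')) < e" if "m \<le> n" "m \<le> n'" for n n'
        using M.triangle [of "T (vs n)" "T (vs m)" "T (vs n')"] dist [OF that(1)] dist [OF that(2)] m
        by (simp add: range_T M.commute)
      then show "\<exists>m. \<forall>n n'. m \<le> n \<longrightarrow> m \<le> n' \<longrightarrow> norm_dist W N (T (vs n)) (T (vs n')) < e"
        by blast
    qed (auto simp: range_T)
    then have lim: "limitin M.mtopology (\<lambda>k. T (vs k)) (T v) sequentially"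
      using complete closed [OF vs] unfolding M.mcomplete_def by metis
    \<comment> \<open>The summand 1 of the bound pays for passing from some \<open>T (vs n)\<close>
      to the limit.\<close>
    then obtain n where "norm_dist W N (T (vs n)) (T v) < 1"
      unfolding M.limit_metric_sequentially by (meson order_refl zero_less_one)
    moreover have "norm_dist W N (T (vs n)) (T (vs 0)) \<le> 2 * C"
      using dist [of 0 n] by simp
    ultimately have "norm_dist W N (T v) (T (vs 0)) \<le> 2 * C + 1"
      using M.triangle [of "T v" "T (vs n)" "T (vs 0)"] by (simp add: range_T M.commute)
    moreover have "T (vs 0) = 0"
      by (simp add: vs_def x T.zero)
    ultimately show ?thesis
      using range_T [of "vs 0"] by (simp add: norm_dist_def range_T)
  qed
  \<comment> \<open>Scaling by \<open>r / 2\<close> moves the closed unit ball strictly inside the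
    ball of radius \<open>r\<close>; the factor \<open>2 / r\<close> undoes it.\<close>
  have "N (T v) \<le> 2 / r * (2 * C + 1) * norm v" for v
  proof (rule bound_of_unit_ball_bound)
    fix u :: 'v
    assume "norm u \<le> 1"
    then have "norm (scaleV (of_real (r / 2)) u) < r"
      using r mult_left_mono [of "norm u" 1 r] by (simp add: V.norm_scale)
    from small [OF this] show "N (T u) \<le> 2 / r * (2 * C + 1)"
      using r by (simp add: T.scale N_scale range_T field_simps)
  qed
  then show thesis
    by (rule that)
qed

text \<open>Finiteness matters because \<open>enn2real\<close> sends infinity to 0.\<close>

lemma N_le_B_norm:
  assumes "B f = T" and "B_norm N B f < \<infinity>"
  shows "N (T v) \<le> enn2real (B_norm N B f) * norm v"
proof (rule bound_of_unit_ball_bound)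
  fix u :: 'v
  assume "norm u \<le> 1"
  then have "ennreal (N (T u)) \<le> B_norm N B f"
    using assms(1) by (auto simp: B_norm_def intro: SUP_upper2)
  from enn2real_mono [OF this] show "N (T u) \<le> enn2real (B_norm N B f)"
    using assms(2) by (simp add: N_nonneg range_T)
qed

end

section \<open>Characterization of \<open>B\<close>-normed spaces\<close>

theorem corollary2p1:
  fixes D :: "'d set"
    and scaleX :: "'k::real_normed_field \<Rightarrow> 'x::banach \<Rightarrow> 'x"
    and scaleV :: "'k \<Rightarrow> 'v::banach \<Rightarrow> 'v"
    and scaleM :: "'k \<Rightarrow> 'm::ab_group_add \<Rightarrow> 'm"
    and W :: "('d \<Rightarrow> 'x) set"
    and normW :: "('d \<Rightarrow> 'x) \<Rightarrow> real"
    and B :: "'m \<Rightarrow> 'v \<Rightarrow> 'd \<Rightarrow> 'x"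
  assumes "D \<noteq> {}"
    and "banach_space_over scaleX"
    and "banach_space_over scaleV"
    and "banach_function_space scaleX D W normW"
    and "vector_space scaleM"
    and "\<And>f v. B f v \<in> W"
    and "bilinear_over scaleM scaleV (pointwise_scale scaleX) B"
    and "BK_space scaleX D W normW"
  shows "B_normed scaleM normW B \<longleftrightarrow>
    (\<forall>f. (\<forall>v. B f v = 0) \<longrightarrow> f = 0) \<and>
    (\<forall>vs v. vs \<longlonglongrightarrow> v \<longrightarrow>
      (\<forall>a\<in>D. \<forall>f. (\<lambda>k. B f (vs k) a) \<longlonglongrightarrow> B f v a))"
proof -
  interpret normed_functions scaleX D W normW
    using assms(2,4) by (simp add: normed_functions_def normed_functions_axioms_def
        banach_space_over_def banach_function_space_def)
  have linear_right: "Vector_Spaces.linear scaleV (pointwise_scale scaleX) (B f)"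
    and linear_left: "Vector_Spaces.linear scaleM (pointwise_scale scaleX) (\<lambda>f. B f v)" for f v
    using assms(7) by (auto simp: bilinear_over_def)
  have operator: "operator_into_functions scaleX D W normW scaleV (B f)" for f
    using linear_right assms(3,6) normed_functions_axioms
    by (simp add: operator_into_functions_def operator_into_functions_axioms_def)
  have diff_right: "B f (v - w) = B f v - B f w" for f v w
    by (rule module_hom.diff [OF Vector_Spaces.linear.axioms(3) [OF linear_right]])
  have zero_left: "B 0 v = 0"
    and add_left: "B (f + g) v = B f v + B g v"
    and scale_left: "B (scaleM c f) v = pointwise_scale scaleX c (B f v)" for f g c v
    using Vector_Spaces.linear.axioms(3) [OF linear_left]
    by (rule module_hom.zero module_hom.add module_hom.scale)+
  have complete: "M.mcomplete"
    using assms(4) by (simp add: banach_function_space_def)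
  \<comment> \<open>Continuous evaluations in sequential form. They yield (II) from norm
    convergence, and later the closed graph from (II).\<close>
  have eval: "(\<lambda>k. u k a) \<longlonglongrightarrow> w a" if "limitin M.mtopology u w sequentially" "a \<in> D" for u w a
    using continuous_map_limit [of M.mtopology euclidean "\<lambda>u. u a" u w sequentially] that assms(8)
    by (simp add: BK_space_def continuous_evaluations_def o_def)
  have bound: "normW (B f v) \<le> enn2real (B_norm normW B f) * norm v"
    if "B_norm normW B f < \<infinity>" for f v
    using operator refl that by (rule operator_into_functions.N_le_B_norm)
  have B_norm_eq_0: "B_norm normW B f = 0" if "\<And>v. B f v = 0" for f
    using that by (simp add: B_norm_def N_0 flip: bot_ennreal)
  show ?thesis
  proof (intro iffI conjI allI ballI impI)
    fix f
    assume B: "B_normed scaleM normW B" and "\<forall>v. B f v = 0"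
    then have "enn2real (B_norm normW B f) = 0"
      by (simp add: B_norm_eq_0)
    then show "f = 0"
      using B by (auto simp: B_normed_def is_norm_on_def)
  next
    fix vs :: "nat \<Rightarrow> 'v" and v a f
    assume B: "B_normed scaleM normW B" and vs: "vs \<longlonglongrightarrow> v" and a: "a \<in> D"
    let ?K = "enn2real (B_norm normW B f)"
    \<comment> \<open>The operator bound at \<open>vs k - v\<close> gives convergence in the norm of
      \<open>W\<close>, which evaluation at \<open>a\<close> turns into (II).\<close>
    have le: "normW (B f (vs k) - B f v) \<le> ?K * norm (vs k - v)" for k
      using bound [of f "vs k - v"] B by (simp add: B_normed_def diff_right)
    have null: "(\<lambda>k. ?K * norm (vs k - v)) \<longlonglongrightarrow> 0"
      by (intro tendsto_mult_right_zero tendsto_norm_zero LIM_zero vs)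
    have dist_le: "norm (norm_dist W normW (B f (vs k)) (B f v)) \<le> ?K * norm (vs k - v)" for k
      using le [of k] N_nonneg [OF diff_mem [OF assms(6) assms(6)]]
      by (simp add: norm_dist_def assms(6))
    have "(\<lambda>k. norm_dist W normW (B f (vs k)) (B f v)) \<longlonglongrightarrow> 0"
      by (rule Lim_null_comparison [OF always_eventually [rule_format, OF dist_le] null])
    then have "limitin M.mtopology (\<lambda>k. B f (vs k)) (B f v) sequentially"
      by (simp add: M.limitin_metric_dist_null assms(6))
    from eval [OF this a] show "(\<lambda>k. B f (vs k) a) \<longlonglongrightarrow> B f v a" .
  next
    assume props: "(\<forall>f. (\<forall>v. B f v = 0) \<longrightarrow> f = 0) \<and>
      (\<forall>vs v. vs \<longlonglongrightarrow> v \<longrightarrow> (\<forall>a\<in>D. \<forall>f. (\<lambda>k. B f (vs k) a) \<longlonglongrightarrow> B f v a))"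
    note I = conjunct1 [OF props, rule_format] and II = conjunct2 [OF props, rule_format]
    have finite: "B_norm normW B f < \<infinity>" for f
    proof -
      \<comment> \<open>On \<open>D\<close> the values \<open>B f (vs k) a\<close> tend to
        \<open>w a\<close> by evaluation and to \<open>B f v a\<close> by (II); off \<open>D\<close>
        both functions vanish.\<close>
      have graph: "w = B f v"
        if "vs \<longlonglongrightarrow> v" and w: "limitin M.mtopology (\<lambda>k. B f (vs k)) w sequentially" for vs v w
      proof
        fix a
        show "w a = B f v a"
        proof (cases "a \<in> D")
          case True
          show ?thesis
            using eval [OF w True] II [OF that(1) True] by (rule LIMSEQ_unique)
        next
          case False
          have "w \<in> W" using w by (simp add: M.limitin_metric)
          then show ?thesis
            using False by (simp add: eq_0_outside assms(6))
        qed
      qed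
      obtain K where K: "\<And>v. normW (B f v) \<le> K * norm v"
        by (rule operator_into_functions.closed_graph [OF operator complete]) (erule (1) graph, rule that)
      \<comment> \<open>The sign of \<open>K\<close> is unknown, so its absolute value serves as the
        bound on the unit ball.\<close>
      have "normW (B f v) \<le> \<bar>K\<bar>" if "norm v \<le> 1" for v
        using K [of v] mult_mono [OF abs_ge_self [of K] that] by simp
      then have "B_norm normW B f \<le> ennreal \<bar>K\<bar>"
        unfolding B_norm_def by (intro SUP_least ennreal_leI) simp
      then show ?thesis
        using ennreal_less_top order_le_less_trans by (metis infinity_ennreal_def)
    qed
    \<comment> \<open>A zero norm forces \<open>B f v = 0\<close> for all \<open>v\<close> by
      \<open>bound\<close>, and then (I) applies.\<close>
    have zero: "enn2real (B_norm normW B f) = 0 \<longleftrightarrow> f = 0" for f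
    proof
      assume "enn2real (B_norm normW B f) = 0"
      then have "normW (B f v) = 0" for v
        using bound [OF finite, of f v] N_nonneg [OF assms(6), of f v] by simp
      then have "B f v = 0" for v
        by (simp add: N_eq_0_iff assms(6))
      then show "f = 0"
        by (rule I)
    qed (simp add: B_norm_eq_0 zero_left)
    \<comment> \<open>Homogeneity and the triangle inequality are shown for suprema in
      \<open>ennreal\<close>; \<open>finite\<close> then carries the triangle inequality over to the
      reals.\<close>
    have scale: "B_norm normW B (scaleM c f) = ennreal (norm c) * B_norm normW B f" for c f
      by (simp add: B_norm_def scale_left N_scale assms(6) SUP_mult_left_ennreal ennreal_mult N_nonneg)
    have add: "B_norm normW B (f + g) \<le> B_norm normW B f + B_norm normW B g" for f g
      unfolding B_norm_def
    proof (rule SUP_least)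
      fix v :: 'v
      assume v: "v \<in> {v. norm v \<le> 1}"
      have "ennreal (normW (B (f + g) v)) \<le> ennreal (normW (B f v)) + ennreal (normW (B g v))"
        by (simp add: add_left N_triangle N_nonneg assms(6) ennreal_leI flip: ennreal_plus)
      also have "\<dots> \<le> (SUP v\<in>{v. norm v \<le> 1}. ennreal (normW (B f v))) +
          (SUP v\<in>{v. norm v \<le> 1}. ennreal (normW (B g v)))"
        using v by (intro add_mono SUP_upper)
      finally show "ennreal (normW (B (f + g) v)) \<le> \<dots>" .
    qed
    have "enn2real (B_norm normW B (f + g)) \<le>
        enn2real (B_norm normW B f) + enn2real (B_norm normW B g)" for f g
      using enn2real_mono [OF add, of f g] finite [of f] finite [of g] by (simp add: enn2real_plus)
    then show "B_normed scaleM normW B"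
      by (simp add: B_normed_def is_norm_on_def finite [simplified] zero scale enn2real_mult)
  qed
qed

end
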